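(* Let $T\subset\mathbb{R}^3$ be a nondegenerate closed tetrahedron with vertices $x_1,x_2,x_3,x_4$, let $\varepsilon>0$ and let $\beta:T\to\mathbb{R}^3$ be a vector field. Then for every $x\in T$ the following linear system of six scalar equations in the unknowns $(j,\phi)\in\mathbb{R}^3\times\mathbb{R}^3$ has a unique solution: $$j\cdot\frac{l_s\times l_t}{2}-B_2^\varepsilon(\sigma_s,\sigma_t)\,\phi\cdot l_s+B_2^\varepsilon(\sigma_t,\sigma_s)\,\phi\cdot l_t=B_2^\varepsilon(\sigma_{12},-\sigma_1)\,\delta_{1s,2t},\qquad 1\le s<t\le 4,$$ where $\delta_{1s,2t}=1$ if $(s,t)=(1,2)$ and $0$ otherwise.
   Context: For $x\in T$: $l_i:=x_i-x$, $\sigma_i:=\beta(x)\cdot l_i$ for $1\le i\le4$, and $\sigma_{ij}:=\beta(x)\cdot(x_j-x_i)$. The 2D-Bernoulli function $B_2^\varepsilon:\mathbb{R}^2\to(0,\infty)$ is $$B_2^\varepsilon(a,b):=\varepsilon\,\frac{\int_0^1 e^{a y_1/\varepsilon}\,dy_1}{2\int_0^1\int_0^{1-y_2}e^{(a y_1+b y_2)/\varepsilon}\,dy_1dy_2}.$$ The unknowns $\phi$ and $j$ are the values at $x$ of the $H(\mathrm{curl})$ exponentially-fitted basis function associated with the edge joining $x_1$ and $x_2$ and of its discrete flux. *)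

theory Defs
  imports "HOL-Analysis.Analysis"
begin

definition bernoulli2 :: "real \<Rightarrow> real \<Rightarrow> real \<Rightarrow> real" where
  "bernoulli2 \<epsilon> a b =
     \<epsilon> * (integral {0..1} (\<lambda>y1. exp (a * y1 / \<epsilon>)) /
          (2 * integral {0..1} (\<lambda>y2. integral {0..1 - y2} (\<lambda>y1. exp ((a * y1 + b * y2) / \<epsilon>)))))"

text \<open>The four vertices are \<open>v 1, \<dots>, v 4\<close>; other values of \<open>v\<close> are never used.
  Injectivity is stated separately because \<^const>\<open>affine_dependent\<close> speaks about the
  set of vertices and does not see repetitions.\<close>

definition nondegenerate_tetrahedron :: "(nat \<Rightarrow> real^3) \<Rightarrow> (real^3) set \<Rightarrow> bool" where
  "nondegenerate_tetrahedron v T \<longleftrightarrow>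
     inj_on v {1..4} \<and> \<not> affine_dependent (v ` {1..4}) \<and> T = convex hull (v ` {1..4})"

definition lvec :: "(nat \<Rightarrow> real^3) \<Rightarrow> real^3 \<Rightarrow> nat \<Rightarrow> real^3" where
  "lvec v x i = v i - x"

definition sigma_vertex :: "(nat \<Rightarrow> real^3) \<Rightarrow> (real^3 \<Rightarrow> real^3) \<Rightarrow> real^3 \<Rightarrow> nat \<Rightarrow> real" where
  "sigma_vertex v \<beta> x i = \<beta> x \<bullet> lvec v x i"

definition sigma_edge :: "(nat \<Rightarrow> real^3) \<Rightarrow> (real^3 \<Rightarrow> real^3) \<Rightarrow> real^3 \<Rightarrow> nat \<Rightarrow> nat \<Rightarrow> real" where
  "sigma_edge v \<beta> x i k = \<beta> x \<bullet> (v k - v i)"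

end

theory Submission
  imports Defs
begin

text \<open>
  The system is square, so it suffices that the homogeneous one has only the zero solution.
  Let \<open>\<lambda>\<close> be barycentric coordinates of \<open>x\<close>, so that \<open>\<Sum>s. \<lambda> s l\<^sub>s = 0\<close>. Weighting the equations with
  \<open>\<lambda>\<close> eliminates \<open>j\<close> and leaves, with \<open>a s = \<phi> \<bullet> l\<^sub>s\<close>, the balance equations for the numbers
  \<open>\<lambda> s * a s\<close> of a Markov chain that jumps from \<open>s\<close> to \<open>t\<close> at rate \<open>\<lambda> t * B(\<sigma>\<^sub>s, \<sigma>\<^sub>t)\<close>. Its
  stationary vectors have constant sign, so \<open>\<Sum>s. \<lambda> s * a s = 0\<close> forces \<open>\<lambda> s * a s = 0\<close> for all \<open>s\<close>,
  and then the balance equations give \<open>a = 0\<close>, also at vertices with \<open>\<lambda> s = 0\<close>. Hence \<open>\<phi> = 0\<close>, and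
  \<open>j\<close> is orthogonal to all \<open>l\<^sub>s \<times> l\<^sub>t\<close>. Of the Bernoulli function only positivity is used.
\<close>

section \<open>Positivity of the Bernoulli function\<close>

text \<open>Strict positivity is asked only at the left end because the outer integrand in the
  denominator of \<open>bernoulli2\<close> vanishes at \<open>y2 = 1\<close>, where the inner
  interval degenerates.\<close>

lemma integral_pos_real:
  fixes f :: "real \<Rightarrow> real"
  assumes "a < b" "continuous_on {a..b} f" "\<And>y. y \<in> {a..b} \<Longrightarrow> 0 \<le> f y" "0 < f a"
  shows "0 < integral {a..b} f"
proof -
  have "integral {a..b} f \<noteq> 0"
    using assms integral_eq_0_iff[OF assms(2,1,3)] by fastforce
  moreover have "0 \<le> integral {a..b} f"
    using assms by (intro integral_nonneg integrable_continuous_interval) auto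
  ultimately show ?thesis by simp
qed

lemma bernoulli2_pos:
  assumes "\<epsilon> > 0"
  shows "bernoulli2 \<epsilon> a b > 0"
proof -
  define G where "G = (\<lambda>u. integral {0..u} (\<lambda>y. exp (a * y / \<epsilon>)))"
  have cont: "continuous_on A (\<lambda>y. exp (a * y / \<epsilon>))" for A
    using assms by (intro continuous_intros) auto
  have G_pos: "0 < G u" if "0 < u" for u
    unfolding G_def using that cont by (intro integral_pos_real) auto
  have G_nonneg: "0 \<le> G u" for u
    unfolding G_def by (intro integral_nonneg integrable_continuous_interval cont) auto
  have "continuous_on {0..1} G"
    unfolding G_def by (intro indefinite_integral_continuous_1 integrable_continuous_interval cont)
  then have cont_G: "continuous_on {0..1} (\<lambda>y. G (1 - y))"
    by (rule continuous_on_compose2) (auto intro!: continuous_intros)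
  \<comment> \<open>Splitting the exponential makes the inner integral an antiderivative evaluated
    at \<open>1 - y2\<close>, which gives continuity in \<open>y2\<close>.\<close>
  have "(\<lambda>y2. integral {0..1 - y2} (\<lambda>y1. exp ((a * y1 + b * y2) / \<epsilon>)))
      = (\<lambda>y2. exp (b * y2 / \<epsilon>) * G (1 - y2))"
    unfolding G_def by (simp flip: integral_mult_right exp_add add: add_divide_distrib add.commute)
  moreover have "0 < integral {0..1} (\<lambda>y2. exp (b * y2 / \<epsilon>) * G (1 - y2))"
    using assms G_pos[of 1] G_nonneg
    by (intro integral_pos_real continuous_intros cont_G) auto
  moreover have "0 < integral {0..1} (\<lambda>y. exp (a * y / \<epsilon>))"
    using G_pos[of 1] by (simp add: G_def)
  ultimately show ?thesis
    unfolding bernoulli2_def using assms by simp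
qed

section \<open>Stationary vectors of the Markov chain\<close>

text \<open>Cut the states into those with \<open>a > 0\<close> and the rest. Stationarity makes the
  net flow across the cut zero, yet every flow between positively weighted states on the two sides
  leaves the positive side. So one positive state of positive weight leaves no weight on the other
  side, and the mean would be positive.\<close>

lemma balanced_vanishes_on_positive:
  fixes lam a :: "'i \<Rightarrow> real" and w :: "'i \<Rightarrow> 'i \<Rightarrow> real"
  assumes "finite I"
    and w: "\<And>s t. 0 < w s t"
    and lam: "\<And>s. s \<in> I \<Longrightarrow> 0 \<le> lam s"
    and mean: "(\<Sum>s\<in>I. lam s * a s) = 0"
    and bal: "\<And>t. t \<in> I \<Longrightarrow> (\<Sum>s\<in>I. lam s * (w s t * a s - w t s * a t)) = 0"
    and "t \<in> I" "0 < a t"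
  shows "lam t = 0"
proof (rule ccontr)
  assume "lam t \<noteq> 0"
  define P where "P = {s \<in> I. 0 < a s}"
  define Q where "Q = I - P"
  \<comment> \<open>\<open>f r s\<close> is the net flow from \<open>s\<close> into
    \<open>r\<close>; it is antisymmetric, so the flows inside \<open>P\<close> cancel.\<close>
  define f where "f = (\<lambda>r s. lam r * lam s * (w s r * a s - w r s * a r))"
  have PQ: "I = P \<union> Q" "P \<inter> Q = {}" "finite P" "finite Q"
    using \<open>finite I\<close> by (auto simp: P_def Q_def)
  have t: "t \<in> P" "0 < lam t"
    using assms \<open>lam t \<noteq> 0\<close> by (auto simp: P_def order.strict_iff_order)
  have "(\<Sum>r\<in>P. \<Sum>s\<in>P. f r s) = (\<Sum>r\<in>P. \<Sum>s\<in>P. f s r)"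
    by (rule sum.swap)
  also have "\<dots> = - (\<Sum>r\<in>P. \<Sum>s\<in>P. f r s)"
    by (simp add: f_def flip: sum_negf) (simp add: algebra_simps)
  finally have "(\<Sum>r\<in>P. \<Sum>s\<in>P. f r s) = 0" by simp
  moreover have "(\<Sum>r\<in>P. \<Sum>s\<in>I. f r s) = 0"
  proof (rule sum.neutral, rule ballI)
    fix r assume "r \<in> P"
    have "(\<Sum>s\<in>I. f r s) = lam r * (\<Sum>s\<in>I. lam s * (w s r * a s - w r s * a r))"
      by (simp add: f_def sum_distrib_left mult.assoc)
    then show "(\<Sum>s\<in>I. f r s) = 0"
      using bal[of r] \<open>r \<in> P\<close> PQ by simp
  qed
  ultimately have outflow: "(\<Sum>r\<in>P. \<Sum>s\<in>Q. - f r s) = 0"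
    using PQ by (simp add: sum.union_disjoint sum.distrib sum_negf)
  have neg: "w s r * a s - w r s * a r < 0" if "r \<in> P" "s \<in> Q" for r s
  proof -
    have "w s r * a s \<le> 0"
      using that w[of s r] by (auto simp: P_def Q_def mult_nonneg_nonpos)
    moreover have "0 < w r s * a r"
      using that w[of r s] by (simp add: P_def)
    ultimately show ?thesis by linarith
  qed
  have f_nonpos: "0 \<le> - f r s" if "r \<in> P" "s \<in> Q" for r s
    using neg[OF that] lam that PQ(1)
    by (auto simp: f_def intro!: mult_nonneg_nonpos)
  have "lam s = 0" if "s \<in> Q" for s
  proof -
    have "(\<Sum>s\<in>Q. - f t s) = 0"
      using outflow t PQ f_nonpos by (subst (asm) sum_nonneg_eq_0_iff) (auto intro!: sum_nonneg)
    then have "f t s = 0"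
      using t that PQ f_nonpos by (subst (asm) sum_nonneg_eq_0_iff) auto
    then show ?thesis
      using neg[OF t(1) that] t(2) by (auto simp: f_def)
  qed
  then have "(\<Sum>s\<in>P. lam s * a s) = 0"
    using mean PQ by (simp add: sum.union_disjoint)
  moreover have "0 < (\<Sum>s\<in>P. lam s * a s)"
    using PQ(3) t(1)
  proof (rule sum_pos2)
    show "0 < lam t * a t" using t(2) \<open>0 < a t\<close> by simp
    show "0 \<le> lam s * a s" if "s \<in> P" for s using that lam by (simp add: P_def)
  qed
  ultimately show False by simp
qed

text \<open>The previous lemma for \<open>a\<close> and for \<open>- a\<close> gives
  \<open>lam s * a s = 0\<close> everywhere. This kills the inflow into \<open>t\<close>, and the
  outflow is \<open>a t\<close> times a positive total rate, even when
  \<open>lam t = 0\<close>.\<close>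

lemma balanced_eq_0:
  fixes lam a :: "'i \<Rightarrow> real" and w :: "'i \<Rightarrow> 'i \<Rightarrow> real"
  assumes "finite I"
    and w: "\<And>s t. 0 < w s t"
    and lam: "\<And>s. s \<in> I \<Longrightarrow> 0 \<le> lam s"
    and "sum lam I \<noteq> 0"
    and mean: "(\<Sum>s\<in>I. lam s * a s) = 0"
    and bal: "\<And>t. t \<in> I \<Longrightarrow> (\<Sum>s\<in>I. lam s * (w s t * a s - w t s * a t)) = 0"
    and "t \<in> I"
  shows "a t = 0"
proof -
  have zero: "lam s * a s = 0" if "s \<in> I" for s
  proof -
    have "lam s = 0" if "0 < a s"
      using balanced_vanishes_on_positive[of I w lam a s] assms \<open>s \<in> I\<close> that by blast
    moreover have "lam s = 0" if "a s < 0"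
    proof (rule balanced_vanishes_on_positive[of I w lam "\<lambda>s. - a s" s])
      show "(\<Sum>s\<in>I. lam s * (w s t * - a s - w t s * - a t)) = 0" if "t \<in> I" for t
      proof -
        have "(\<Sum>s\<in>I. lam s * (w s t * - a s - w t s * - a t))
            = - (\<Sum>s\<in>I. lam s * (w s t * a s - w t s * a t))"
          by (simp add: algebra_simps flip: sum_negf)
        then show ?thesis using bal[OF that] by simp
      qed
    qed (use assms \<open>s \<in> I\<close> that in \<open>auto simp: sum_negf\<close>)
    ultimately show ?thesis by (cases "a s" "0 :: real" rule: linorder_cases) auto
  qed
  have "lam s * (w s t * a s - w t s * a t) = - (a t * (lam s * w t s))" if "s \<in> I" for s
    using zero[OF that] by (auto simp: algebra_simps)
  then have "a t * (\<Sum>s\<in>I. lam s * w t s) = 0"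
    using bal[OF \<open>t \<in> I\<close>] by (simp add: sum_negf sum_distrib_left)
  moreover obtain s where "s \<in> I" "lam s \<noteq> 0"
    using \<open>sum lam I \<noteq> 0\<close> by (rule sum.not_neutral_contains_not_neutral)
  have "0 < (\<Sum>s\<in>I. lam s * w t s)"
    using \<open>finite I\<close> \<open>s \<in> I\<close>
  proof (rule sum_pos2)
    show "0 < lam s * w t s" using lam[OF \<open>s \<in> I\<close>] \<open>lam s \<noteq> 0\<close> w by simp
    show "0 \<le> lam r * w t r" if "r \<in> I" for r using lam[OF that] w[of t r] by simp
  qed
  ultimately show ?thesis by simp
qed

section \<open>Geometry of the tetrahedron\<close>

lemma orthogonal_to_affine_basis:
  fixes S :: "'a::euclidean_space set"
  assumes "\<not> affine_dependent S" "card S = DIM('a) + 1"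
    and "\<And>p. p \<in> S \<Longrightarrow> z \<bullet> (p - x) = 0"
  shows "z = 0"
proof -
  have "aff_dim S = DIM('a)"
    using aff_dim_affine_independent[OF assms(1)] assms(2) by simp
  then have "affine hull S = UNIV"
    by (simp add: aff_dim_eq_full)
  moreover have "affine hull S \<subseteq> {p. z \<bullet> p = z \<bullet> x}"
    using assms(3) by (intro hull_minimal affine_hyperplane) (auto simp: inner_diff_right)
  \<comment> \<open>The hyperplane contains every point; testing \<open>z + x\<close> yields z
    \<bullet> z = 0.\<close>
  ultimately have "z \<bullet> (z + x) = z \<bullet> x" by blast
  then show ?thesis by (simp add: inner_add_right)
qed

lemma ordered_pairs_4:
  "(\<forall>s t. 1 \<le> s \<and> s < t \<and> t \<le> 4 \<longrightarrow> P s t) \<longleftrightarrow>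
     P 1 2 \<and> P 1 3 \<and> P 1 4 \<and> P 2 3 \<and> P 2 4 \<and> P (3::nat) (4::nat)"
proof -
  have "1 \<le> s \<and> s < t \<and> t \<le> 4 \<longleftrightarrow>
      (s, t) \<in> {(1,2), (1,3), (1,4), (2,3), (2,4), (3,4)}" for s t :: nat
    by auto
  then show ?thesis by auto
qed

context
  fixes v :: "nat \<Rightarrow> real^3" and T :: "(real^3) set" and x :: "real^3"
  assumes tetra: "nondegenerate_tetrahedron v T" and "x \<in> T"
begin

lemma orthogonal_lvec:
  assumes "\<And>i. i \<in> {1..4} \<Longrightarrow> z \<bullet> lvec v x i = 0"
  shows "z = 0"
proof (rule orthogonal_to_affine_basis)
  show "\<not> affine_dependent (v ` {1..4})" "card (v ` {1..4}) = DIM(real^3) + 1"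
    using tetra by (auto simp: nondegenerate_tetrahedron_def card_image)
  show "z \<bullet> (p - x) = 0" if "p \<in> v ` {1..4}" for p
    using assms that by (auto simp: lvec_def)
qed

lemma orthogonal_cross_lvec:
  assumes "\<And>s t. s \<in> {1..4} \<Longrightarrow> t \<in> {1..4} \<Longrightarrow> j \<bullet> cross3 (lvec v x s) (lvec v x t) = 0"
  shows "j = 0"
proof -
  \<comment> \<open>The cyclic symmetry of the triple product moves \<open>j\<close> into the cross
    product; a second use frees the other factor.\<close>
  have "cross3 (lvec v x t) j = 0" if "t \<in> {1..4}" for t
    using assms that by (intro orthogonal_lvec) (metis cross_triple inner_commute)
  then have "cross3 j u = 0" for u
    by (intro orthogonal_lvec) (metis cross_triple inner_commute inner_zero_left)
  from this[of "axis 1 1"] this[of "axis 2 1"] show ?thesis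
    by (simp add: cross3_def vec_eq_iff forall_3 axis_def)
qed

lemma barycentric_lvec:
  obtains lam :: "nat \<Rightarrow> real"
  where "\<And>i. i \<in> {1..4} \<Longrightarrow> 0 \<le> lam i" "sum lam {1..4} = 1"
    "(\<Sum>i\<in>{1..4}. lam i *\<^sub>R lvec v x i) = 0"
proof -
  have inj: "inj_on v {1..4}" and "x \<in> convex hull (v ` {1..4})"
    using tetra \<open>x \<in> T\<close> by (auto simp: nondegenerate_tetrahedron_def)
  then obtain u where u: "\<forall>p\<in>v ` {1..4}. 0 \<le> u p" "sum u (v ` {1..4}) = 1"
      "(\<Sum>p\<in>v ` {1..4}. u p *\<^sub>R p) = x"
    by (auto simp: convex_hull_finite)
  show thesis
  proof
    show "0 \<le> (u \<circ> v) i" if "i \<in> {1..4}" for i using u(1) that by auto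
    show one: "sum (u \<circ> v) {1..4} = 1" using u(2) by (simp only: sum.reindex[OF inj])
    have "(\<Sum>i\<in>{1..4}. (u \<circ> v) i *\<^sub>R v i) = x" using u(3) by (simp only: sum.reindex[OF inj] o_def)
    then show "(\<Sum>i\<in>{1..4}. (u \<circ> v) i *\<^sub>R lvec v x i) = 0"
      using one unfolding lvec_def
      by (simp only: scaleR_diff_right sum_subtractf flip: scaleR_sum_left) simp
  qed
qed

section \<open>Unique solvability of the system\<close>

lemma homogeneous_system_trivial:
  fixes w :: "nat \<Rightarrow> nat \<Rightarrow> real"
  assumes w: "\<And>s t. 0 < w s t"
    and eq: "\<And>s t. 1 \<le> s \<Longrightarrow> s < t \<Longrightarrow> t \<le> 4 \<Longrightarrow>
      j \<bullet> ((1/2) *\<^sub>R cross3 (lvec v x s) (lvec v x t))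
        - w s t * (\<phi> \<bullet> lvec v x s) + w t s * (\<phi> \<bullet> lvec v x t) = 0"
  shows "j = 0" "\<phi> = 0"
proof -
  define l where "l = lvec v x"
  \<comment> \<open>Both sides are antisymmetric in \<open>s\<close> and \<open>t\<close>, so the
    six equations extend to all pairs, as the balance sums require.\<close>
  have flux: "w s t * (\<phi> \<bullet> l s) - w t s * (\<phi> \<bullet> l t) = j \<bullet> ((1/2) *\<^sub>R cross3 (l s) (l t))"
    if "s \<in> {1..4}" "t \<in> {1..4}" for s t
    using eq[of s t] eq[of t s] that cross_skew[of "l s" "l t"]
    by (cases s t rule: linorder_cases) (auto simp: l_def)
  obtain lam :: "nat \<Rightarrow> real" where lam: "\<And>i. i \<in> {1..4} \<Longrightarrow> 0 \<le> lam i" "sum lam {1..4} = 1"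
      "(\<Sum>i\<in>{1..4}. lam i *\<^sub>R l i) = 0"
    using barycentric_lvec unfolding l_def by metis
  have lam_lin: "(\<Sum>s\<in>{1..4}. lam s * f (l s)) = 0" if "linear f" for f :: "real^3 \<Rightarrow> real"
    using arg_cong[OF lam(3), of f] that
    by (simp add: linear_sum linear_cmul linear_0)
  have "\<phi> \<bullet> l t = 0" if "t \<in> {1..4}" for t
  proof (rule balanced_eq_0[of "{1..4}" w lam "\<lambda>s. \<phi> \<bullet> l s"])
    show "(\<Sum>s\<in>{1..4}. lam s * (\<phi> \<bullet> l s)) = 0"
      by (rule lam_lin) (simp add: bounded_linear.linear bounded_linear_inner_right)
    show "(\<Sum>s\<in>{1..4}. lam s * (w s t * (\<phi> \<bullet> l s) - w t s * (\<phi> \<bullet> l t))) = 0"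
      if "t \<in> {1..4}" for t
    proof -
      \<comment> \<open>The flux is linear in \<open>l s\<close>, so the barycentric relation
        annihilates its weighted sum.\<close>
      have "linear (\<lambda>u. j \<bullet> ((1/2) *\<^sub>R cross3 u (l t)))"
        by (rule linearI)
          (simp_all add: cross_add_left cross_mult_left inner_add_right scaleR_add_right)
      then show ?thesis
        by (subst sum.cong[OF refl arg_cong[OF flux[OF _ that]]]) (assumption, rule lam_lin)
    qed
  qed (use w lam that in auto)
  then show "\<phi> = 0"
    by (intro orthogonal_lvec) (auto simp: l_def)
  then show "j = 0"
    using flux by (intro orthogonal_cross_lvec) (auto simp: l_def)
qed

lemma square_system_unique_solution:
  fixes w :: "nat \<Rightarrow> nat \<Rightarrow> real" and c :: "nat \<Rightarrow> nat \<Rightarrow> real"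
  assumes w: "\<And>s t. 0 < w s t"
  shows "\<exists>!p. \<forall>s t. 1 \<le> s \<and> s < t \<and> t \<le> 4 \<longrightarrow>
    fst p \<bullet> ((1/2) *\<^sub>R cross3 (lvec v x s) (lvec v x t))
      - w s t * (snd p \<bullet> lvec v x s) + w t s * (snd p \<bullet> lvec v x t) = c s t"
proof -
  define e where "e = (\<lambda>s t p. fst p \<bullet> ((1/2) *\<^sub>R cross3 (lvec v x s) (lvec v x t))
      - w s t * (snd p \<bullet> lvec v x s) + w t s * (snd p \<bullet> lvec v x t))"
  \<comment> \<open>Packing the six left-hand sides into two triples makes \<open>L\<close> an
    endomorphism, so that injectivity implies surjectivity.\<close>
  define L :: "(real^3) \<times> (real^3) \<Rightarrow> (real^3) \<times> (real^3)" where
    "L = (\<lambda>p. (vector [e 1 2 p, e 1 3 p, e 1 4 p], vector [e 2 3 p, e 2 4 p, e 3 4 p]))"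
  define d :: "(real^3) \<times> (real^3)" where
    "d = (vector [c 1 2, c 1 3, c 1 4], vector [c 2 3, c 2 4, c 3 4])"
  have L_eq: "(\<forall>s t. 1 \<le> s \<and> s < t \<and> t \<le> 4 \<longrightarrow> e s t p = c s t) \<longleftrightarrow> L p = d" for p
    unfolding ordered_pairs_4
    by (simp add: L_def d_def vec_eq_iff forall_3 vector_3 conj_assoc)
  have e_add: "e s t (p + q) = e s t p + e s t q" and e_scale: "e s t (k *\<^sub>R p) = k * e s t p"
    for s t p q k
    by (simp_all add: e_def inner_add_left algebra_simps)
  have "linear L"
    by (rule linearI)
      (simp_all add: L_def e_add e_scale vec_eq_iff forall_3 vector_3 prod_eq_iff)
  moreover have "inj L"
    unfolding linear_injective_0[OF \<open>linear L\<close>]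
  proof (intro allI impI)
    fix p assume "L p = 0"
    then have "\<forall>s t. 1 \<le> s \<and> s < t \<and> t \<le> 4 \<longrightarrow> e s t p = 0"
      unfolding ordered_pairs_4
      by (simp add: L_def vec_eq_iff forall_3 vector_3 prod_eq_iff)
    then show "p = 0"
      using homogeneous_system_trivial[of w "fst p" "snd p"] w
      by (auto simp: e_def prod_eq_iff)
  qed
  ultimately have "bij L"
    by (simp add: bij_def linear_injective_imp_surjective)
  then have "\<exists>!p. L p = d"
    by (metis bij_pointE)
  then show ?thesis
    unfolding L_eq[symmetric] by (simp add: e_def)
qed

end

theorem lemma3p1:
  fixes v :: "nat \<Rightarrow> real^3" and T :: "(real^3) set"
    and \<epsilon> :: real and \<beta> :: "real^3 \<Rightarrow> real^3" and x :: "real^3"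
  assumes "nondegenerate_tetrahedron v T"
    and "\<epsilon> > 0"
    and "x \<in> T"
  shows "\<exists>!p :: (real^3) \<times> (real^3). case p of (j, \<phi>) \<Rightarrow>
    (\<forall>s t. 1 \<le> s \<and> s < t \<and> t \<le> 4 \<longrightarrow>
       j \<bullet> ((1/2) *\<^sub>R cross3 (lvec v x s) (lvec v x t))
       - bernoulli2 \<epsilon> (sigma_vertex v \<beta> x s) (sigma_vertex v \<beta> x t) * (\<phi> \<bullet> lvec v x s)
       + bernoulli2 \<epsilon> (sigma_vertex v \<beta> x t) (sigma_vertex v \<beta> x s) * (\<phi> \<bullet> lvec v x t)
       = bernoulli2 \<epsilon> (sigma_edge v \<beta> x 1 2) (- sigma_vertex v \<beta> x 1)
         * (if (s, t) = (1, 2) then 1 else 0))"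
  unfolding case_prod_unfold
  by (rule square_system_unique_solution[OF assms(1,3)]) (rule bernoulli2_pos[OF assms(2)])

end
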